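(* Let $(X,T)$ be an M-system. Assume that $\omega_{\mathcal{N}_T}(x)\neq\varnothing$ for every minimal point $x\in X$. Then $(X,T)$ is weakly mixing. In particular, each transitive compact M-system is weakly mixing.
   Context: A dynamical system $(X,T)$ consists of a nonempty compact metric space $X$ (metric $d$) and a continuous surjective map $T:X\to X$; by standing assumption $X$ has no isolated points and is not a singleton. $\mathbb{Z}_+$ is the set of nonnegative integers. "Opene" means open and nonempty. For opene $U,V\subset X$ put $N_T(U,V)=\{n\in\mathbb{Z}_+: U\cap T^{-n}V\neq\varnothing\}$, and for $x\in X$, $G\subset X$ put $N_T(x,G)=\{n\in\mathbb{Z}_+: T^nx\in G\}$. $\mathcal{N}_T$ is the set of all subsets of $\mathbb{Z}_+$ containing some $N_T(U,V)$ with $U,V$ opene. For $x\in X$, $\omega_{\mathcal{N}_T}(x)=\bigcap_{F\in\mathcal{N}_T}\overline{\{T^ix:i\in F\}}$, i.e. the set of $z\in X$ such that $N_T(x,G)\cap N_T(U,V)\neq\varnothing$ for every neighborhood $G$ of $z$ and all opene $U,V\subset X$. The system is transitive compact if $\omega_{\mathcal{N}_T}(x)\neq\varnothing$ for every $x\in X$. The system is transitive if $N_T(U,V)\neq\varnothing$ for all opene $U,V\subset X$, and weakly mixing if $(X\times X,T\times T)$ is transitive. A point is minimal if it lies in a minimal subset, i.e. a nonempty closed set $A$ with $TA=A$ such that every $T|_A$-orbit $\{T^na:n\ge 0\}$, $a\in A$, is dense in $A$. An M-system is a transitive system with a dense set of minimal points. *)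

theory Defs
  imports "HOL-Analysis.Analysis"
begin

text \<open>A system is given by a carrier set \<open>X\<close> in an ambient space and a map \<open>T\<close>, of which only
  the values on \<open>X\<close> matter. All topological notions (open, closed, dense) are relative to
  \<open>X\<close>, i.e. refer to \<^term>\<open>top_of_set X\<close>.\<close>

definition dynamical_system :: "'a::metric_space set \<Rightarrow> ('a \<Rightarrow> 'a) \<Rightarrow> bool" where
  "dynamical_system X T \<longleftrightarrow>
     X \<noteq> {} \<and> compact X \<and> continuous_on X T \<and> T ` X = X \<and>
     (\<forall>x\<in>X. x islimpt X) \<and> \<not> is_singleton X"

definition opene :: "'a::topological_space set \<Rightarrow> 'a set \<Rightarrow> bool" where
  "opene X U \<longleftrightarrow> openin (top_of_set X) U \<and> U \<noteq> {}"

definition hitting_times :: "('a \<Rightarrow> 'a) \<Rightarrow> 'a set \<Rightarrow> 'a set \<Rightarrow> nat set" where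
  "hitting_times T U V = {n. U \<inter> (T ^^ n) -` V \<noteq> {}}"

definition hitting_family :: "'a::topological_space set \<Rightarrow> ('a \<Rightarrow> 'a) \<Rightarrow> nat set set" where
  "hitting_family X T = {F. \<exists>U V. opene X U \<and> opene X V \<and> hitting_times T U V \<subseteq> F}"

definition omega_hitting :: "'a::topological_space set \<Rightarrow> ('a \<Rightarrow> 'a) \<Rightarrow> 'a \<Rightarrow> 'a set" where
  "omega_hitting X T x =
     (\<Inter>F\<in>hitting_family X T. top_of_set X closure_of ((\<lambda>i. (T ^^ i) x) ` F))"

definition transitive_compact :: "'a::topological_space set \<Rightarrow> ('a \<Rightarrow> 'a) \<Rightarrow> bool" where
  "transitive_compact X T \<longleftrightarrow> (\<forall>x\<in>X. omega_hitting X T x \<noteq> {})"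

definition transitive_system :: "'a::topological_space set \<Rightarrow> ('a \<Rightarrow> 'a) \<Rightarrow> bool" where
  "transitive_system X T \<longleftrightarrow>
     (\<forall>U V. opene X U \<longrightarrow> opene X V \<longrightarrow> hitting_times T U V \<noteq> {})"

definition weakly_mixing :: "'a::topological_space set \<Rightarrow> ('a \<Rightarrow> 'a) \<Rightarrow> bool" where
  "weakly_mixing X T \<longleftrightarrow> transitive_system (X \<times> X) (map_prod T T)"

definition minimal_subset :: "'a::topological_space set \<Rightarrow> ('a \<Rightarrow> 'a) \<Rightarrow> 'a set \<Rightarrow> bool" where
  "minimal_subset X T A \<longleftrightarrow>
     A \<noteq> {} \<and> closedin (top_of_set X) A \<and> T ` A = A \<and>
     (\<forall>a\<in>A. top_of_set A closure_of (range (\<lambda>n. (T ^^ n) a)) = A)"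

definition minimal_point :: "'a::topological_space set \<Rightarrow> ('a \<Rightarrow> 'a) \<Rightarrow> 'a \<Rightarrow> bool" where
  "minimal_point X T x \<longleftrightarrow> (\<exists>A. minimal_subset X T A \<and> x \<in> A)"

definition M_system :: "'a::topological_space set \<Rightarrow> ('a \<Rightarrow> 'a) \<Rightarrow> bool" where
  "M_system X T \<longleftrightarrow>
     transitive_system X T \<and> top_of_set X closure_of {x. minimal_point X T x} = X"

end

theory Submission
  imports Defs
begin

text \<open>Write \<open>N(U,V)\<close> for the hitting times. The argument passes through
  the return times \<open>N(W,W)\<close>.

  First, in a transitive system it suffices for weak mixing that every \<open>N(W,W)\<close> meets every
  \<open>N(U,V)\<close>: given \<open>U\<^sub>1, V\<^sub>1, U\<^sub>2, V\<^sub>2\<close>, choose \<open>n\<close> such that \<open>W = U\<^sub>1 \<inter> T\<^sup>-\<^sup>n V\<^sub>1\<close> is nonempty; a common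
  element \<open>j\<close> of \<open>N(W,W)\<close> and \<open>N(U\<^sub>2, T\<^sup>-\<^sup>n V\<^sub>2)\<close> then gives the common element \<open>j + n\<close> of
  \<open>N(U\<^sub>1,V\<^sub>1)\<close> and \<open>N(U\<^sub>2,V\<^sub>2)\<close> (lemma \<open>weakly_mixing_if_return_times_meet\<close>).

  Second, let \<open>W\<close> contain a minimal point \<open>x\<close>, and let \<open>z\<close> be a point of \<open>omega_hitting X T x\<close>.
  The orbit of \<open>x\<close> is guaranteed to come near \<open>z\<close> at a time taken from any prescribed hitting set,
  but \<open>z\<close> itself may lie outside \<open>W\<close>. Minimality repairs this: \<open>z\<close> lies in the orbit closure of
  \<open>x\<close>, so the orbit of \<open>z\<close> enters \<open>W\<close> after some fixed delay \<open>k\<close>, and so do the points near \<open>z\<close>.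
  The delay is absorbed by prescribing \<open>N(U, T\<^sup>-\<^sup>k V)\<close> instead of \<open>N(U,V)\<close>
  (lemma \<open>return_times_meet_hitting_times\<close>). In an M-system every \<open>W\<close> contains a minimal
  point.\<close>

lemma mem_hitting_times: "n \<in> hitting_times T U V \<longleftrightarrow> (\<exists>u\<in>U. (T ^^ n) u \<in> V)"
  by (auto simp: hitting_times_def)

lemma funpow_image_eq: "T ` X = X \<Longrightarrow> (T ^^ n) ` X = X"
  by (induction n) (simp_all only: funpow.simps image_id id_apply image_comp [symmetric])

lemma funpow_mem: "T ` X = X \<Longrightarrow> x \<in> X \<Longrightarrow> (T ^^ n) x \<in> X"
  using funpow_image_eq by blast

lemma continuous_on_funpow:
  assumes "continuous_on X T" "T ` X = X"
  shows "continuous_on X (T ^^ n)"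
proof (induction n)
  case (Suc n)
  then have "continuous_on X (T \<circ> T ^^ n)"
    using assms by (intro continuous_on_compose) (simp_all only: funpow_image_eq)
  then show ?case by simp
qed (simp add: id_def)

lemma openin_funpow_vimage:
  assumes "continuous_on X T" "T ` X = X" "openin (top_of_set X) V"
  shows "openin (top_of_set X) (X \<inter> (T ^^ n) -` V)"
proof (rule continuous_openin_preimage [OF continuous_on_funpow [OF assms(1,2)] _ assms(3)])
  show "T ^^ n \<in> X \<rightarrow> X"
    using assms(2) by (blast intro: funpow_mem)
qed

lemma opene_funpow_vimage:
  assumes "continuous_on X T" "T ` X = X" "opene X V"
  shows "opene X (X \<inter> (T ^^ n) -` V)"
proof -
  obtain v where "v \<in> V" "v \<in> X"
    using assms(3) openin_imp_subset by (fastforce simp: opene_def)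
  then obtain u where "u \<in> X" "(T ^^ n) u = v"
    using funpow_image_eq [OF assms(2)] by (metis imageE)
  then show ?thesis
    using assms \<open>v \<in> V\<close> openin_funpow_vimage by (fastforce simp: opene_def)
qed

lemma omega_hittingD:
  assumes "z \<in> omega_hitting X T x" "opene X U" "opene X V"
    and "openin (top_of_set X) G" "z \<in> G"
  obtains n where "n \<in> hitting_times T U V" "(T ^^ n) x \<in> G"
proof -
  have "hitting_times T U V \<in> hitting_family X T"
    using assms by (auto simp: hitting_family_def)
  then have "z \<in> top_of_set X closure_of ((\<lambda>i. (T ^^ i) x) ` hitting_times T U V)"
    using assms(1) by (auto simp: omega_hitting_def)
  then show ?thesis
    using assms(4,5) that by (auto simp: in_closure_of)
qed

text \<open>As soon as there is an opene set, all of \<open>\<nat>\<close> belongs to the hitting family, so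
  \<open>omega_hitting X T x\<close> lies in the orbit closure of \<open>x\<close>, which stays inside a closed invariant set.\<close>

lemma omega_hitting_subset_minimal_subset:
  assumes "minimal_subset X T A" "x \<in> A" "opene X U"
  shows "omega_hitting X T x \<subseteq> A"
proof
  fix z assume "z \<in> omega_hitting X T x"
  moreover have "UNIV \<in> hitting_family X T"
    using assms(3) by (auto simp: hitting_family_def)
  ultimately have "z \<in> top_of_set X closure_of (range (\<lambda>i. (T ^^ i) x))"
    by (auto simp: omega_hitting_def)
  moreover have "range (\<lambda>i. (T ^^ i) x) \<subseteq> A"
    using assms(1,2) funpow_mem by (fastforce simp: minimal_subset_def)
  ultimately show "z \<in> A"
    using assms(1) closure_of_minimal unfolding minimal_subset_def by blast
qed

lemma minimal_subset_orbit_enters: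
  assumes "minimal_subset X T A" "z \<in> A" "openin (top_of_set X) W" "x \<in> W" "x \<in> A"
  obtains k where "(T ^^ k) z \<in> W"
proof -
  have "A \<subseteq> X"
    using assms(1) closedin_subset by (fastforce simp: minimal_subset_def)
  moreover obtain S where "open S" "W = X \<inter> S"
    using assms(3) by (auto simp: openin_open)
  ultimately have "openin (top_of_set A) (A \<inter> W)"
    by (auto simp: openin_open)
  moreover have "x \<in> top_of_set A closure_of (range (\<lambda>n. (T ^^ n) z))"
    using assms(1,2,5) by (auto simp: minimal_subset_def)
  moreover have "x \<in> A \<inter> W"
    using assms(4,5) by simp
  ultimately obtain y where "y \<in> range (\<lambda>n. (T ^^ n) z)" "y \<in> A \<inter> W"
    unfolding in_closure_of by metis
  then show ?thesis using that by auto
qed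

text \<open>A visit of \<open>x\<close> near \<open>z\<close> at time \<open>i\<close> becomes a return to \<open>W\<close> at time \<open>i + k\<close>, where \<open>k\<close> is the
  delay after which \<open>z\<close> enters \<open>W\<close>. Surjectivity of \<open>T\<close> keeps \<open>T\<^sup>-\<^sup>k V\<close> nonempty, so \<open>i\<close> can be
  taken from \<open>N(U, T\<^sup>-\<^sup>k V)\<close>, which makes \<open>i + k\<close> an element of \<open>N(U,V)\<close>.\<close>

lemma return_times_meet_hitting_times:
  assumes "continuous_on X T" "T ` X = X"
    and "minimal_point X T x" "omega_hitting X T x \<noteq> {}"
    and W: "openin (top_of_set X) W" "x \<in> W" and "opene X U" "opene X V"
  shows "hitting_times T W W \<inter> hitting_times T U V \<noteq> {}"
proof -
  obtain A z where A: "minimal_subset X T A" "x \<in> A" and z: "z \<in> omega_hitting X T x"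
    using assms(3,4) by (auto simp: minimal_point_def)
  have "z \<in> A"
    using omega_hitting_subset_minimal_subset A z \<open>opene X U\<close> by blast
  then have "z \<in> X"
    using A(1) closedin_subset by (fastforce simp: minimal_subset_def)
  obtain k where k: "(T ^^ k) z \<in> W"
    using minimal_subset_orbit_enters [OF A(1) \<open>z \<in> A\<close> W A(2)] .
  obtain i where i: "i \<in> hitting_times T U (X \<inter> (T ^^ k) -` V)"
      "(T ^^ i) x \<in> X \<inter> (T ^^ k) -` W"
  proof (rule omega_hittingD [OF z \<open>opene X U\<close>])
    show "opene X (X \<inter> (T ^^ k) -` V)"
      using assms by (intro opene_funpow_vimage)
    show "openin (top_of_set X) (X \<inter> (T ^^ k) -` W)"
      using assms by (intro openin_funpow_vimage)
    show "z \<in> X \<inter> (T ^^ k) -` W"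
      using \<open>z \<in> X\<close> k by simp
  qed
  have "k + i \<in> hitting_times T W W"
    using i(2) W(2) by (auto simp: mem_hitting_times funpow_add)
  moreover have "k + i \<in> hitting_times T U V"
    using i(1) by (auto simp: mem_hitting_times funpow_add)
  ultimately show ?thesis by blast
qed

lemma funpow_map_prod:
  fixes f :: "'a \<Rightarrow> 'a" and g :: "'b \<Rightarrow> 'b"
  shows "(map_prod f g ^^ n) (a, b) = ((f ^^ n) a, (g ^^ n) b)"
  by (induction n) simp_all

lemma opene_Times_contains_rectangle:
  assumes "opene (X \<times> Y) U"
  obtains A B where "opene X A" "opene Y B" "A \<times> B \<subseteq> U"
proof -
  obtain S where S: "open S" "U = (X \<times> Y) \<inter> S"
    using assms by (auto simp: opene_def openin_open)
  obtain a b where ab: "a \<in> X" "b \<in> Y" "(a, b) \<in> S"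
    using assms S(2) by (auto simp: opene_def)
  obtain A B where "open A" "open B" "(a, b) \<in> A \<times> B" "A \<times> B \<subseteq> S"
    using open_prod_elim [OF S(1) ab(3)] by metis
  then have "opene X (X \<inter> A)" "opene Y (Y \<inter> B)" "(X \<inter> A) \<times> (Y \<inter> B) \<subseteq> U"
    using ab S(2) by (auto simp: opene_def openin_open_Int)
  then show ?thesis using that by blast
qed

text \<open>On rectangles, transitivity of \<open>T \<times> T\<close> asks for a common element of two hitting sets.\<close>

lemma weakly_mixingI:
  assumes "\<And>U1 V1 U2 V2. \<lbrakk>opene X U1; opene X V1; opene X U2; opene X V2\<rbrakk>
    \<Longrightarrow> hitting_times T U1 V1 \<inter> hitting_times T U2 V2 \<noteq> {}"
  shows "weakly_mixing X T"
  unfolding weakly_mixing_def transitive_system_def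
proof (intro allI impI)
  fix U V assume "opene (X \<times> X) U" "opene (X \<times> X) V"
  then obtain U1 U2 V1 V2 where opene: "opene X U1" "opene X U2" "opene X V1" "opene X V2"
    and sub: "U1 \<times> U2 \<subseteq> U" "V1 \<times> V2 \<subseteq> V"
    by (elim opene_Times_contains_rectangle)
  obtain n where n: "n \<in> hitting_times T U1 V1" "n \<in> hitting_times T U2 V2"
    using assms [OF opene(1,3,2,4)] by blast
  then obtain a b where "a \<in> U1" "(T ^^ n) a \<in> V1" "b \<in> U2" "(T ^^ n) b \<in> V2"
    by (auto simp: mem_hitting_times)
  then have "(a, b) \<in> U" "(map_prod T T ^^ n) (a, b) \<in> V"
    using sub by (auto simp: funpow_map_prod)
  then show "hitting_times (map_prod T T) U V \<noteq> {}"
    using mem_hitting_times by blast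
qed

text \<open>Transitivity turns returns into arbitrary transitions: a point of \<open>U1\<close> that is in
  \<open>U1 \<inter> T\<^sup>-\<^sup>n V1\<close> at time \<open>j\<close> is in \<open>V1\<close> at time \<open>n + j\<close>. The same shift by \<open>n\<close> is built into
  the second transition by aiming at \<open>T\<^sup>-\<^sup>n V2\<close>.\<close>

lemma weakly_mixing_if_return_times_meet:
  assumes "continuous_on X T" "T ` X = X" "transitive_system X T"
    and meet: "\<And>W U V. \<lbrakk>opene X W; opene X U; opene X V\<rbrakk>
      \<Longrightarrow> hitting_times T W W \<inter> hitting_times T U V \<noteq> {}"
  shows "weakly_mixing X T"
proof (rule weakly_mixingI)
  fix U1 V1 U2 V2
  assume opene: "opene X U1" "opene X V1" "opene X U2" "opene X V2"
  obtain n u where u: "u \<in> U1" "(T ^^ n) u \<in> V1"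
    using assms(3) opene(1,2) unfolding transitive_system_def
    by (metis all_not_in_conv mem_hitting_times)
  let ?W = "U1 \<inter> (X \<inter> (T ^^ n) -` V1)"
  have "u \<in> X"
    using u(1) opene(1) openin_imp_subset by (fastforce simp: opene_def)
  then have "opene X ?W"
    using u opene openin_funpow_vimage [OF assms(1,2)] by (auto simp: opene_def)
  moreover have "opene X (X \<inter> (T ^^ n) -` V2)"
    using assms(1,2) opene(4) by (rule opene_funpow_vimage)
  ultimately obtain j where j: "j \<in> hitting_times T ?W ?W"
      "j \<in> hitting_times T U2 (X \<inter> (T ^^ n) -` V2)"
    using meet opene(3) by blast
  have "n + j \<in> hitting_times T U1 V1" "n + j \<in> hitting_times T U2 V2"
    using j by (auto simp: mem_hitting_times funpow_add)
  then show "hitting_times T U1 V1 \<inter> hitting_times T U2 V2 \<noteq> {}" by blast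
qed

theorem corollary3p10:
  fixes X :: "'a::metric_space set" and T :: "'a \<Rightarrow> 'a"
  assumes "dynamical_system X T"
    and "M_system X T"
  shows "((\<forall>x. minimal_point X T x \<longrightarrow> omega_hitting X T x \<noteq> {}) \<longrightarrow> weakly_mixing X T) \<and>
         (transitive_compact X T \<longrightarrow> weakly_mixing X T)"
proof -
  have T: "continuous_on X T" "T ` X = X"
    using assms(1) by (auto simp: dynamical_system_def)
  have trans: "transitive_system X T"
    and dense: "top_of_set X closure_of {x. minimal_point X T x} = X"
    using assms(2) by (auto simp: M_system_def)
  have wm: "weakly_mixing X T"
    if omega: "\<And>x. minimal_point X T x \<Longrightarrow> omega_hitting X T x \<noteq> {}"
  proof (rule weakly_mixing_if_return_times_meet [OF T trans])
    fix W U V assume "opene X W" and UV: "opene X U" "opene X V"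
    then have W: "openin (top_of_set X) W" "W \<noteq> {}"
      by (auto simp: opene_def)
    then obtain w where w: "w \<in> W" "w \<in> X"
      using openin_imp_subset by blast
    then have "w \<in> top_of_set X closure_of {x. minimal_point X T x}"
      by (simp only: dense)
    then obtain x where "minimal_point X T x" "x \<in> W"
      using W(1) w(1) by (auto simp: in_closure_of)
    then show "hitting_times T W W \<inter> hitting_times T U V \<noteq> {}"
      using return_times_meet_hitting_times [OF T] omega W(1) UV by blast
  qed
  have "x \<in> X" if "minimal_point X T x" for x
    using that closedin_subset by (fastforce simp: minimal_point_def minimal_subset_def)
  then show ?thesis
    using wm by (auto simp: transitive_compact_def)
qed

end
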